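(* Let $k\ge1$ and $n\ge1$. The family $\mathrm{SEQ}(\mathcal{B})_n(k)$ of sequences of $k$-bundled increasing trees of total order $n$ is in bijection with the family $\mathcal{A}_n(k+2)$ of $(k+2)$-ary increasing trees of order $n$.
   Context: A $k$-bundled increasing tree is a rooted tree with vertex labels increasing along every path away from the root, in which every vertex has $k$ ordered bundles, each containing a (possibly empty) linearly ordered sequence of children; each non-root vertex lies in exactly one bundle of its parent. $\mathrm{SEQ}(\mathcal{B})_n(k)$ is the set of finite (ordered, possibly of any length) sequences $(t_1,\dots,t_r)$ of $k$-bundled increasing trees whose label sets are pairwise disjoint and together form a partition of $\{1,\dots,n\}$ (each $t_i$ being increasing with respect to its own labels). A $(k+2)$-ary increasing tree of order $n$ is a rooted tree on $\{1,\dots,n\}$ with root $1$ and labels increasing along paths away from the root, in which every vertex has $k+2$ positions numbered $1,\dots,k+2$, each empty or occupied by exactly one child, every non-root vertex occupying exactly one position of its parent. *)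

theory Defs
  imports Main
begin

text \<open>
  Vertices are identified with their labels, so a tree is given by a label and the (ordered)
  children at each vertex. The labels of one tree are required to be distinct; this does not
  follow from the labels increasing along paths.
\<close>

subsection \<open>Bundled increasing trees\<close>

datatype btree = BNode (broot: nat) (bundles: "btree list list")

fun blabels :: "btree \<Rightarrow> nat list" where
  "blabels (BNode a bs) = a # concat (map (\<lambda>b. concat (map blabels b)) bs)"

fun k_bundled :: "nat \<Rightarrow> btree \<Rightarrow> bool" where
  "k_bundled k (BNode a bs) \<longleftrightarrow>
     length bs = k \<and> (\<forall>b \<in> set bs. \<forall>t \<in> set b. k_bundled k t)"

fun bincreasing :: "btree \<Rightarrow> bool" where
  "bincreasing (BNode a bs) \<longleftrightarrow>
     (\<forall>b \<in> set bs. \<forall>t \<in> set b. a < broot t \<and> bincreasing t)"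

text \<open>The label set of a bundled increasing tree may be any finite nonempty set of naturals.\<close>

definition bundled_increasing_tree :: "nat \<Rightarrow> btree \<Rightarrow> bool" where
  "bundled_increasing_tree k t \<longleftrightarrow>
     k_bundled k t \<and> distinct (blabels t) \<and> bincreasing t"

definition SEQ_B :: "nat \<Rightarrow> nat \<Rightarrow> btree list set" where
  "SEQ_B n k = {ts.
     (\<forall>t \<in> set ts. bundled_increasing_tree k t) \<and>
     (\<forall>i j. i < j \<longrightarrow> j < length ts \<longrightarrow>
        set (blabels (ts ! i)) \<inter> set (blabels (ts ! j)) = {}) \<and>
     (\<Union>t \<in> set ts. set (blabels t)) = {1..n}}"

subsection \<open>Increasing trees with numbered positions\<close>

text \<open>The \<open>i\<close>-th entry of the list is position \<open>i + 1\<close>; \<open>None\<close> means that it is empty.\<close>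

datatype atree = ANode (aroot: nat) (positions: "atree option list")

fun alabels :: "atree \<Rightarrow> nat list" where
  "alabels (ANode a ps) =
     a # concat (map (\<lambda>p. case p of None \<Rightarrow> [] | Some t \<Rightarrow> alabels t) ps)"

fun m_ary :: "nat \<Rightarrow> atree \<Rightarrow> bool" where
  "m_ary m (ANode a ps) \<longleftrightarrow>
     length ps = m \<and> (\<forall>p \<in> set ps. \<forall>t \<in> set_option p. m_ary m t)"

fun aincreasing :: "atree \<Rightarrow> bool" where
  "aincreasing (ANode a ps) \<longleftrightarrow>
     (\<forall>p \<in> set ps. \<forall>t \<in> set_option p. a < aroot t \<and> aincreasing t)"

definition ary_increasing_trees :: "nat \<Rightarrow> nat \<Rightarrow> atree set" where
  "ary_increasing_trees n m = {t.
     m_ary m t \<and> distinct (alabels t) \<and> set (alabels t) = {1..n} \<and>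
     aroot t = 1 \<and> aincreasing t}"

end

theory Submission
  imports Defs "HOL-Library.Multiset"
begin

text \<open>
  In a nonempty sequence of increasing trees with disjoint label sets, the smallest label \<open>a\<close> is
  the root of exactly one tree. The trees to its left, the \<open>k\<close> bundles of \<open>a\<close>, and the trees to
  its right are \<open>k + 2\<close> (possibly empty) shorter sequences of the same kind. Turning each of them
  recursively into the content of one position of \<open>a\<close>, where an empty sequence gives an empty
  position, yields a \<open>(k + 2)\<close>-ary increasing tree. The function \<open>forest\<close> is the inverse of this map.
\<close>

fun forest :: "atree \<Rightarrow> btree list" where
  "forest (ANode a ps) =
     (let fs = map (\<lambda>p. case p of None \<Rightarrow> [] | Some t \<Rightarrow> forest t) ps
      in hd fs @ BNode a (butlast (tl fs)) # last fs)"

abbreviation position_forest :: "atree option \<Rightarrow> btree list" where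
  "position_forest p \<equiv> (case p of None \<Rightarrow> [] | Some t \<Rightarrow> forest t)"

abbreviation position_labels :: "atree option \<Rightarrow> nat list" where
  "position_labels p \<equiv> (case p of None \<Rightarrow> [] | Some t \<Rightarrow> alabels t)"

section \<open>Label lists of sequences of trees\<close>

definition forest_labels :: "btree list \<Rightarrow> nat list" where
  "forest_labels ts = concat (map blabels ts)"

lemma forest_labels_simps [simp]:
  "forest_labels [] = []"
  "forest_labels (t # ts) = blabels t @ forest_labels ts"
  "forest_labels (ts @ us) = forest_labels ts @ forest_labels us"
  by (simp_all add: forest_labels_def)

lemma set_forest_labels: "set (forest_labels ts) = (\<Union>t\<in>set ts. set (blabels t))"
  by (auto simp: forest_labels_def)

text \<open>Bundles and whole sequences are both lists of trees. Once this replaces the defining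
  equation as simp rule, \<open>forest_labels\<close> treats the two alike.\<close>

lemma blabels_eq: "blabels (BNode a bs) = a # concat (map forest_labels bs)"
  by (simp add: forest_labels_def[abs_def])

declare blabels.simps [simp del]
declare blabels_eq [simp]

lemma broot_in_blabels: "broot t \<in> set (blabels t)"
  by (cases t) simp

lemma aroot_in_alabels: "aroot t \<in> set (alabels t)"
  by (cases t) simp

section \<open>Shape and labels of \<open>forest t\<close>\<close>

lemma forest_not_Nil [simp]: "forest t \<noteq> []"
  by (cases t) (simp add: Let_def)

lemma list_eq_hd_middle_last:
  assumes "length xs \<ge> 2"
  shows "xs = hd xs # butlast (tl xs) @ [last xs]"
proof -
  have "xs \<noteq> []" "tl xs \<noteq> []"
    using assms by (cases xs; force)+
  then show ?thesis
    by (metis append_butlast_last_id last_tl list.collapse)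
qed

text \<open>With at least two positions, \<open>hd\<close>, \<open>butlast (tl _)\<close> and
  \<open>last\<close> cut the list of sequences without overlap and without unspecified values. All
  later arguments about \<open>forest\<close> work with this cut.\<close>

lemma forest_ANode_obtain:
  assumes "length ps = k + 2"
  obtains xs bs ys where "map position_forest ps = xs # bs @ [ys]" "length bs = k"
    "forest (ANode a ps) = xs @ BNode a bs # ys"
proof
  let ?fs = "map position_forest ps"
  show "?fs = hd ?fs # butlast (tl ?fs) @ [last ?fs]"
    using assms by (intro list_eq_hd_middle_last) simp
  show "length (butlast (tl ?fs)) = k"
    using assms by simp
  show "forest (ANode a ps) = hd ?fs @ BNode a (butlast (tl ?fs)) # last ?fs"
    by (simp add: Let_def)
qed

lemma forest_ANode_eq:
  assumes "map position_forest ps = xs # bs @ [ys]"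
  shows "forest (ANode a ps) = xs @ BNode a bs # ys"
  using assms by (simp add: Let_def)

lemma mset_concat_cong:
  assumes "\<And>x. x \<in> set xs \<Longrightarrow> mset (f x) = mset (g x)"
  shows "mset (concat (map f xs)) = mset (concat (map g xs))"
  using assms by (induction xs) auto

text \<open>Only the order changes: \<open>alabels\<close> lists the root first, whereas
  \<open>forest\<close> moves the labels of the first position in front of it. Multisets keep enough
  to transfer both the label set and distinctness.\<close>

lemma mset_forest_labels:
  assumes "m_ary (k + 2) t"
  shows "mset (forest_labels (forest t)) = mset (alabels t)"
  using assms
proof (induction t rule: forest.induct)
  case (1 a ps)
  from 1(2) have "length ps = k + 2" by simp
  from forest_ANode_obtain[OF this, of a] obtain xs bs ys
    where split: "map position_forest ps = xs # bs @ [ys]"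
      and f: "forest (ANode a ps) = xs @ BNode a bs # ys" by metis
  have "mset (forest_labels (position_forest p)) = mset (position_labels p)"
    if "p \<in> set ps" for p
    using 1 that by (cases p) auto
  then have "mset (concat (map (\<lambda>p. forest_labels (position_forest p)) ps))
      = mset (concat (map position_labels ps))"
    by (rule mset_concat_cong)
  also have "map (\<lambda>p. forest_labels (position_forest p)) ps
      = map forest_labels (map position_forest ps)"
    by simp
  finally show ?case
    unfolding f split by simp
qed

lemma set_forest_labels_forest:
  assumes "m_ary (k + 2) t"
  shows "set (forest_labels (forest t)) = set (alabels t)"
  using mset_forest_labels[OF assms] by (rule mset_eq_setD)

section \<open>Minimality of roots; \<open>forest\<close> yields bundled increasing trees\<close>

lemma aroot_le:
  assumes "aincreasing t" "x \<in> set (alabels t)"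
  shows "aroot t \<le> x"
  using assms
proof (induction t rule: forest.induct)
  case (1 a ps)
  show ?case
  proof (cases "x = a")
    case False
    then obtain t where t: "Some t \<in> set ps" "x \<in> set (alabels t)"
      using 1(3) by (auto split: option.splits)
    then have "a < aroot t" "aincreasing t" using 1(2) by auto
    then show ?thesis using 1(1)[OF t(1) refl] t by simp
  qed simp
qed

lemma broot_le:
  assumes "bincreasing t" "x \<in> set (blabels t)"
  shows "broot t \<le> x"
  using assms
proof (induction t rule: bincreasing.induct)
  case (1 a bs)
  show ?case
  proof (cases "x = a")
    case False
    then obtain b t where t: "b \<in> set bs" "t \<in> set b" "x \<in> set (blabels t)"
      using 1(3) by (auto simp: set_forest_labels)
    then have "a < broot t" "bincreasing t" using 1(2) by auto
    then show ?thesis using 1(1)[OF t(1,2)] t by simp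
  qed simp
qed

lemma forest_k_bundled:
  assumes "m_ary (k + 2) t" "u \<in> set (forest t)"
  shows "k_bundled k u"
  using assms
proof (induction t arbitrary: u rule: forest.induct)
  case (1 a ps)
  from 1(2) have "length ps = k + 2" by simp
  from forest_ANode_obtain[OF this, of a] obtain xs bs ys
    where split: "map position_forest ps = xs # bs @ [ys]" and len: "length bs = k"
      and f: "forest (ANode a ps) = xs @ BNode a bs # ys" by metis
  have "k_bundled k v" if "p \<in> set ps" "v \<in> set (position_forest p)" for p v
    using 1(1,2) that by (cases p) auto
  then have "\<forall>b \<in> set (map position_forest ps). \<forall>v \<in> set b. k_bundled k v"
    by (auto simp del: k_bundled.simps)
  then show ?case
    using 1(3) len unfolding f split by auto
qed

text \<open>These labels are those of a child subtree, whose root exceeds \<open>a\<close> and is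
  its least label. Thus \<open>a\<close> can be recovered from the sequence as its minimum.\<close>

lemma position_forest_labels_greater:
  assumes "m_ary (k + 2) (ANode a ps)" "aincreasing (ANode a ps)"
    and "f \<in> set (map position_forest ps)" "x \<in> set (forest_labels f)"
  shows "a < x"
proof -
  obtain t where t: "Some t \<in> set ps" "x \<in> set (forest_labels (forest t))"
    using assms(3,4) by (auto split: option.splits)
  then have "x \<in> set (alabels t)" "aincreasing t" "a < aroot t"
    using assms(1,2) set_forest_labels_forest[of k t] by auto
  then show ?thesis
    using aroot_le by fastforce
qed

lemma position_forest_roots_greater:
  assumes "m_ary (k + 2) (ANode a ps)" "aincreasing (ANode a ps)"
    and "f \<in> set (map position_forest ps)" "u \<in> set f"
  shows "a < broot u"
  using position_forest_labels_greater[OF assms(1-3)] assms(4) broot_in_blabels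
  unfolding set_forest_labels by blast

lemma forest_bincreasing:
  assumes "m_ary (k + 2) t" "aincreasing t" "u \<in> set (forest t)"
  shows "bincreasing u"
  using assms
proof (induction t arbitrary: u rule: forest.induct)
  case (1 a ps)
  from 1(2) have "length ps = k + 2" by simp
  from forest_ANode_obtain[OF this, of a] obtain xs bs ys
    where split: "map position_forest ps = xs # bs @ [ys]"
      and f: "forest (ANode a ps) = xs @ BNode a bs # ys" by metis
  have "bincreasing v" if "p \<in> set ps" "v \<in> set (position_forest p)" for p v
    using 1(1-3) that by (cases p) auto
  then have "\<forall>b \<in> set (map position_forest ps). \<forall>v \<in> set b. a < broot v \<and> bincreasing v"
    using position_forest_roots_greater[OF 1(2,3)] by auto
  then show ?case
    using 1(4) unfolding f split by auto
qed

section \<open>Injectivity of \<open>forest\<close>\<close>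

lemma append_Cons_eq_unique:
  assumes "xs @ x # ys = xs' @ x' # ys'"
    and "P x" "P x'" "\<And>z. z \<in> set xs \<union> set xs' \<Longrightarrow> \<not> P z"
  shows "xs = xs' \<and> x = x' \<and> ys = ys'"
  using assms
\<comment> \<open>\<open>x\<close> and \<open>x'\<close> are each the first entry of the common list
  that satisfies \<open>P\<close>, so both decompositions cut it at the same place.\<close>
proof (induction xs arbitrary: xs')
  case Nil
  then show ?case by (cases xs') auto
next
  case (Cons z zs)
  then show ?case by (cases xs') auto
qed

lemma forest_inject:
  assumes "m_ary (k + 2) t" "aincreasing t" "m_ary (k + 2) t'" "aincreasing t'"
    and "forest t = forest t'"
  shows "t = t'"
  using assms
proof (induction t arbitrary: t' rule: forest.induct)
  case (1 a ps)
  obtain a' ps' where t': "t' = ANode a' ps'" by (cases t')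
  note wf = 1(2,3) and wf' = 1(4,5)[unfolded t']
  have len: "length ps = k + 2" "length ps' = k + 2"
    using wf wf' by simp_all
  from forest_ANode_obtain[OF len(1), of a] obtain xs bs ys
    where split: "map position_forest ps = xs # bs @ [ys]"
      and f: "forest (ANode a ps) = xs @ BNode a bs # ys" by metis
  from forest_ANode_obtain[OF len(2), of a'] obtain xs' bs' ys'
    where split': "map position_forest ps' = xs' # bs' @ [ys']"
      and f': "forest (ANode a' ps') = xs' @ BNode a' bs' # ys'" by metis
  \<comment> \<open>Equal forests carry the same labels, and each root is the least label of its
    tree; hence the roots agree.\<close>
  have "set (alabels (ANode a ps)) = set (alabels (ANode a' ps'))"
    using set_forest_labels_forest[OF wf(1)] set_forest_labels_forest[OF wf'(1)] 1(6)
    unfolding t' by metis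
  then have a: "a' = a"
    using aroot_le[OF wf(2), of a'] aroot_le[OF wf'(2), of a]
      aroot_in_alabels[of "ANode a ps"] aroot_in_alabels[of "ANode a' ps'"]
    by (simp del: alabels.simps)
  \<comment> \<open>No tree to the left of the one rooted at \<open>a\<close> has root
    \<open>a\<close>, so this property of the root locates the cut.\<close>
  have gt: "a < broot u" if "u \<in> set xs \<union> set xs'" for u
    using that position_forest_roots_greater[OF wf, of xs u]
      position_forest_roots_greater[OF wf', of xs' u]
    unfolding split split' a by auto
  have "xs @ BNode a bs # ys = xs' @ BNode a bs' # ys'"
    using 1(6) f f' unfolding t' a by simp
  then have "xs = xs' \<and> BNode a bs = BNode a bs' \<and> ys = ys'"
    by (rule append_Cons_eq_unique[where P = "\<lambda>u. broot u = a"]) (use gt in fastforce)+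
  then have eq: "map position_forest ps = map position_forest ps'"
    unfolding split split' by simp
  have "ps = ps'"
  proof (rule nth_equalityI)
    show "length ps = length ps'" using len by simp
    fix i assume i: "i < length ps"
    then have i': "i < length ps'" using len by simp
    have pf: "position_forest (ps ! i) = position_forest (ps' ! i)"
      using eq i i' by (metis nth_map)
    \<comment> \<open>An empty position gives the empty sequence and an occupied one never does, so
      the sequences tell the two cases apart.\<close>
    show "ps ! i = ps' ! i"
    proof (cases "ps ! i")
      case None
      then show ?thesis using pf by (cases "ps' ! i") (auto dest: sym)
    next
      case (Some u)
      then obtain u' where u': "ps' ! i = Some u'"
        using pf by (cases "ps' ! i") auto
      have mem: "Some u \<in> set ps" "Some u' \<in> set ps'"
        using i i' Some u' by (metis nth_mem)+
      have "u = u'"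
        using 1(1)[OF mem(1) refl, of u'] mem wf wf' pf Some u' by fastforce
      then show ?thesis using Some u' by simp
    qed
  qed
  then show ?case using t' a by simp
qed

section \<open>Surjectivity of \<open>forest\<close>\<close>

lemma distinct_concat_memD: "distinct (concat xss) \<Longrightarrow> xs \<in> set xss \<Longrightarrow> distinct xs"
  by (simp add: distinct_concat_iff)

lemma length_le_length_concat: "xs \<in> set xss \<Longrightarrow> length xs \<le> length (concat xss)"
  by (induction xss) auto

text \<open>The cut is made at a tree with the least root. As the trees are increasing, that root is
  a lower bound of all labels; distinctness makes the bound strict for the others.\<close>

lemma min_root_split:
  assumes "ts \<noteq> []" "\<forall>t \<in> set ts. bincreasing t" "distinct (forest_labels ts)"
  obtains xs a bs ys where "ts = xs @ BNode a bs # ys"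
    "\<And>b x. b \<in> set (xs # bs @ [ys]) \<Longrightarrow> x \<in> set (forest_labels b) \<Longrightarrow> a < x"
proof -
  define t where "t = arg_min_on broot (set ts)"
  have t: "t \<in> set ts" "\<And>u. u \<in> set ts \<Longrightarrow> broot t \<le> broot u"
    using assms(1) arg_min_if_finite(1)[of "set ts" broot] arg_min_least[of "set ts" _ broot]
    unfolding t_def by auto
  obtain a bs where t_eq: "t = BNode a bs" by (cases t)
  obtain xs ys where ts: "ts = xs @ BNode a bs # ys"
    using t(1) unfolding t_eq by (meson split_list)
  show thesis
  proof (rule that[OF ts])
    fix b x assume b: "b \<in> set (xs # bs @ [ys])" and x: "x \<in> set (forest_labels b)"
    have "x \<noteq> a"
      using assms(3) b x unfolding ts by auto
    moreover have "a \<le> x"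
    proof (cases "b \<in> set bs")
      case True
      have "bincreasing t" using assms(2) t(1) by blast
      moreover have "x \<in> set (blabels t)" using True x unfolding t_eq by auto
      ultimately show ?thesis using broot_le unfolding t_eq by fastforce
    next
      case False
      then obtain u where u: "u \<in> set ts" "x \<in> set (blabels u)"
        using b x unfolding ts set_forest_labels by auto
      then have "a \<le> broot u" using t(2) unfolding t_eq by fastforce
      also have "broot u \<le> x" using u assms(2) broot_le by blast
      finally show ?thesis .
    qed
    ultimately show "a < x" by simp
  qed
qed

lemma forest_surj:
  assumes "ts \<noteq> []" "\<forall>t \<in> set ts. k_bundled k t \<and> bincreasing t"
    and "distinct (forest_labels ts)"
  shows "\<exists>t. m_ary (k + 2) t \<and> aincreasing t \<and> forest t = ts"
  using assms
\<comment> \<open>The bundles of \<open>a\<close> are not sublists of \<open>ts\<close>, so the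
  induction runs on the number of labels: each of the \<open>k + 2\<close> sequences lacks at least
  \<open>a\<close>.\<close>
proof (induction "length (forest_labels ts)" arbitrary: ts rule: less_induct)
  case less
  then obtain xs a bs ys where ts: "ts = xs @ BNode a bs # ys"
    and gt: "\<And>b x. b \<in> set (xs # bs @ [ys]) \<Longrightarrow> x \<in> set (forest_labels b) \<Longrightarrow> a < x"
    using min_root_split[of ts] by metis
  let ?fs = "xs # bs @ [ys]"
  have "\<exists>p. position_forest p = b \<and>
      (\<forall>t \<in> set_option p. m_ary (k + 2) t \<and> aincreasing t \<and> a < aroot t)"
    if b: "b \<in> set ?fs" for b
  proof (cases "b = []")
    case True
    then show ?thesis by (intro exI[of _ None]) simp
  next
    case False
    have "length (forest_labels b) \<le> length (concat (map forest_labels ?fs))"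
      using b by (intro length_le_length_concat) auto
    also have "\<dots> < length (forest_labels ts)"
      unfolding ts by simp
    finally have 1: "length (forest_labels b) < length (forest_labels ts)" .
    have 2: "\<forall>t \<in> set b. k_bundled k t \<and> bincreasing t"
      using b less(3) unfolding ts by auto
    have "distinct (concat (map forest_labels ?fs))"
      using less(4) unfolding ts by auto
    then have 3: "distinct (forest_labels b)"
      by (rule distinct_concat_memD) (use b in auto)
    obtain t where t: "m_ary (k + 2) t" "aincreasing t" "forest t = b"
      using less(1)[OF 1 False 2 3] by blast
    have "aroot t \<in> set (forest_labels b)"
      using set_forest_labels_forest[OF t(1)] aroot_in_alabels[of t] t(3) by simp
    then have "a < aroot t" using gt b by blast
    then show ?thesis using t by (intro exI[of _ "Some t"]) simp
  qed
  \<comment> \<open>The content of a position is chosen as a function of the sequence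
    \<open>b\<close> alone, so mapping \<open>g\<close> over the sequences fills all
    positions.\<close>
  then obtain g where g: "\<And>b. b \<in> set ?fs \<Longrightarrow> position_forest (g b) = b"
    "\<And>b t. b \<in> set ?fs \<Longrightarrow> t \<in> set_option (g b) \<Longrightarrow>
       m_ary (k + 2) t \<and> aincreasing t \<and> a < aroot t"
    by metis
  let ?t = "ANode a (map g ?fs)"
  have "length bs = k" using less(3) unfolding ts by simp
  then have "m_ary (k + 2) ?t" using g(2) by auto
  moreover have "aincreasing ?t" using g(2) by auto
  moreover have "forest ?t = ts"
    unfolding ts by (rule forest_ANode_eq) (use g(1) in \<open>auto simp: map_idI\<close>)
  ultimately show ?case by blast
qed

section \<open>Distinct labels in \<open>SEQ_B\<close>, and the bijection\<close>

lemma distinct_forest_labels_iff: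
  "distinct (forest_labels ts) \<longleftrightarrow>
     (\<forall>t \<in> set ts. distinct (blabels t)) \<and>
     (\<forall>i j. i < j \<longrightarrow> j < length ts \<longrightarrow>
        set (blabels (ts ! i)) \<inter> set (blabels (ts ! j)) = {})"
\<comment> \<open>Adding a tree at the end leaves the old indices unchanged; the new pairs are
  exactly those with \<open>j = length ts\<close>.\<close>
proof (induction ts rule: rev_induct)
  case Nil
  then show ?case by simp
next
  case (snoc t ts)
  have "(\<forall>i j. i < j \<longrightarrow> j < length (ts @ [t]) \<longrightarrow>
        set (blabels ((ts @ [t]) ! i)) \<inter> set (blabels ((ts @ [t]) ! j)) = {}) \<longleftrightarrow>
     (\<forall>i j. i < j \<longrightarrow> j < length ts \<longrightarrow>
        set (blabels (ts ! i)) \<inter> set (blabels (ts ! j)) = {}) \<and>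
     (\<forall>i < length ts. set (blabels (ts ! i)) \<inter> set (blabels t) = {})"
    by (auto simp: nth_append less_Suc_eq)
  also have "(\<forall>i < length ts. set (blabels (ts ! i)) \<inter> set (blabels t) = {}) \<longleftrightarrow>
      set (forest_labels ts) \<inter> set (blabels t) = {}"
    unfolding set_forest_labels all_set_conv_all_nth[symmetric, where P = "\<lambda>u. set (blabels u) \<inter> set (blabels t) = {}"]
    by blast
  finally show ?case
    using snoc by auto
qed

lemma SEQ_B_iff:
  "ts \<in> SEQ_B n k \<longleftrightarrow> (\<forall>t \<in> set ts. k_bundled k t \<and> bincreasing t) \<and>
     distinct (forest_labels ts) \<and> set (forest_labels ts) = {1..n}"
  unfolding SEQ_B_def bundled_increasing_tree_def distinct_forest_labels_iff set_forest_labels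
  by auto

lemma bij_betw_forest:
  assumes "n \<ge> 1"
  shows "bij_betw forest (ary_increasing_trees n (k + 2)) (SEQ_B n k)"
  unfolding bij_betw_def
proof
  show "inj_on forest (ary_increasing_trees n (k + 2))"
    by (auto intro!: inj_onI forest_inject simp: ary_increasing_trees_def)
  show "forest ` ary_increasing_trees n (k + 2) = SEQ_B n k"
  proof (intro set_eqI iffI)
    fix ts assume "ts \<in> forest ` ary_increasing_trees n (k + 2)"
    then obtain t where t: "ts = forest t" "m_ary (k + 2) t" "distinct (alabels t)"
      "set (alabels t) = {1..n}" "aincreasing t"
      by (auto simp: ary_increasing_trees_def)
    show "ts \<in> SEQ_B n k"
      unfolding SEQ_B_iff t(1)
      using t(2-) forest_k_bundled forest_bincreasing set_forest_labels_forest
        mset_eq_imp_distinct_iff[OF mset_forest_labels]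
      by blast
  next
    fix ts assume ts: "ts \<in> SEQ_B n k"
    \<comment> \<open>Since \<open>n \<ge> 1\<close>, the label set is nonempty. The empty sequence
      has no preimage, as every tree has a root.\<close>
    then have "ts \<noteq> []" using assms by (auto simp: SEQ_B_iff)
    then obtain t where t: "m_ary (k + 2) t" "aincreasing t" "forest t = ts"
      using ts forest_surj[of ts k] by (auto simp: SEQ_B_iff)
    have "distinct (alabels t)" "set (alabels t) = {1..n}"
      using ts t set_forest_labels_forest[OF t(1)]
        mset_eq_imp_distinct_iff[OF mset_forest_labels[OF t(1)]]
      by (auto simp: SEQ_B_iff)
    \<comment> \<open>The root lies in \<open>{1..n}\<close> and is at most the label 1, which
      occurs because \<open>n \<ge> 1\<close>.\<close>
    moreover from this have "aroot t = 1"
      using assms aroot_le[OF t(2), of 1] aroot_in_alabels[of t] by simp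
    ultimately show "ts \<in> forest ` ary_increasing_trees n (k + 2)"
      using t by (auto simp: ary_increasing_trees_def)
  qed
qed

theorem theorem4p2:
  fixes k n :: nat
  assumes "k \<ge> 1" and "n \<ge> 1"
  shows "\<exists>f. bij_betw f (SEQ_B n k) (ary_increasing_trees n (k + 2))"
  using bij_betw_inv_into[OF bij_betw_forest[OF assms(2)]] by blast

end
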